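(* For every integer $k\ge 2$, $$1-\frac{2}{k-1}\le D(k,\mathbb{Z}^2)\le 1-\frac{2}{k}.$$ Further, if $k$ is not a multiple of $3$, then $D(k,\mathbb{Z}^2)=1-\frac{2}{k}$.
   Context: Notation: $\mathbb{N}=\{1,2,3,\dots\}$, $[n]=\{1,\dots,n\}$. Let $k\ge 2$ be an integer. For $m,n\in\mathbb{N}$, the board $B=[m]\times[n]\subseteq\mathbb{Z}^2$ has as its $k$-lines all sets $\{p+j\vec d: 0\le j\le k-1\}$ with $p\in B$ and $\vec d\in\{-1,0,1\}^2\setminus\{0\}$ that are contained in $B$. A configuration of $B$ is a subset $S\subseteq B$ with $|L\setminus S|\ge 2$ for every $k$-line $L$ of $B$. A saturated configuration is a configuration that is maximal with respect to inclusion among configurations; $\mathcal{S}_k(B)$ is the set of saturated configurations. Define $D(k,B)=\max_{S\in\mathcal{S}_k(B)}|S|/|B|$. Finally $D(k,\mathbb{Z}^2)=\lim_{t\to\infty}D(k,[m(t)]\times[n(t)])$, where $m,n:\mathbb{N}\to\mathbb{N}$ are arbitrary maps with $m(t),n(t)\to\infty$; this limit exists and does not depend on the choice of $m,n$ (in particular one may take $m(t)=n(t)=t$). *)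

theory Defs
  imports Complex_Main
begin

definition board :: "nat \<Rightarrow> nat \<Rightarrow> (int \<times> int) set" where
  "board m n = {1..int m} \<times> {1..int n}"

definition directions :: "(int \<times> int) set" where
  "directions = ({-1, 0, 1} \<times> {-1, 0, 1}) - {(0, 0)}"

definition segment :: "nat \<Rightarrow> int \<times> int \<Rightarrow> int \<times> int \<Rightarrow> (int \<times> int) set" where
  "segment k p d = {(fst p + int j * fst d, snd p + int j * snd d) | j. j < k}"

definition klines :: "nat \<Rightarrow> (int \<times> int) set \<Rightarrow> (int \<times> int) set set" where
  "klines k B = {L. \<exists>p\<in>B. \<exists>d\<in>directions. L = segment k p d \<and> L \<subseteq> B}"

definition configuration :: "nat \<Rightarrow> (int \<times> int) set \<Rightarrow> (int \<times> int) set \<Rightarrow> bool" where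
  "configuration k B S \<longleftrightarrow> S \<subseteq> B \<and> (\<forall>L\<in>klines k B. card (L - S) \<ge> 2)"

definition saturated :: "nat \<Rightarrow> (int \<times> int) set \<Rightarrow> (int \<times> int) set \<Rightarrow> bool" where
  "saturated k B S \<longleftrightarrow>
     configuration k B S \<and> (\<forall>T. configuration k B T \<and> S \<subseteq> T \<longrightarrow> T = S)"

definition board_density :: "nat \<Rightarrow> (int \<times> int) set \<Rightarrow> real" where
  "board_density k B = Max ((\<lambda>S. real (card S) / real (card B)) ` {S. saturated k B S})"

text \<open>The density of the plane is the common limit over all sequences of boards whose two side
  lengths tend to infinity. Empty boards (side length 0) occur only finitely often in such a
  sequence and do not affect the limit.\<close>

definition plane_density :: "nat \<Rightarrow> real" where
  "plane_density k =
     (THE D. \<forall>m n :: nat \<Rightarrow> nat.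
        filterlim m at_top sequentially \<longrightarrow> filterlim n at_top sequentially \<longrightarrow>
        (\<lambda>t. board_density k (board (m t) (n t))) \<longlonglongrightarrow> D)"

end

theory Submission
  imports Defs "HOL-Computational_Algebra.Primes"
begin

text \<open>
  It is convenient to count the cells outside a configuration.  Let \<open>c(m, n)\<close> be the least
  possible number of such cells on the board with sides \<open>m\<close> and \<open>n\<close>.  Every configuration
  extends to a saturated one, so the board density is \<open>1 - c(m, n) / (m n)\<close>.

  Existence of the limit: a configuration restricts to a configuration on every sub-board, so if a
  board is cut in two, then \<open>c\<close> of the whole is at least the sum of \<open>c\<close> over the two parts.  The
  two-dimensional form of Fekete's lemma (\<open>superadditive_limit\<close>) shows that
  \<open>c(m, n) / (m n)\<close> tends to its supremum \<open>L\<close> whenever both sides tend to infinity.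

  Since \<open>L\<close> is a supremum, a single board gives the upper bound on the density: the board with sides
  \<open>k\<close> and \<open>1\<close> is itself a line and needs two free cells, so \<open>L \<ge> 2/k\<close>.

  Since \<open>L\<close> is a limit, one periodic pattern gives the lower bound.  If \<open>q \<ge> 2\<close> is not a multiple
  of \<open>3\<close>, leave free the cells \<open>(x, y)\<close> with \<open>x + 2 y\<close> congruent to \<open>0\<close> or \<open>1\<close> modulo \<open>q\<close>.  Moving
  along a line changes \<open>x + 2 y\<close> in steps of \<open>1\<close>, \<open>2\<close> or \<open>3\<close> up to sign.  A step coprime to
  \<open>q\<close> visits both residues within \<open>q\<close> cells.  The only other possibility is step \<open>2\<close> with \<open>q\<close> even; then
  only residues of one parity are visited, but each of them twice, and exactly one of \<open>0\<close> and
  \<open>1\<close> has this parity.  The free cells have density \<open>2/q\<close>, and lines of length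
  \<open>k \<ge> q\<close> contain lines of length \<open>q\<close>; hence \<open>L \<le> 2/q\<close> (\<open>cover_density_le\<close>).  The theorem uses
  \<open>q = k\<close> if \<open>3\<close> does not divide \<open>k\<close>, and \<open>q = k - 1\<close> otherwise.
\<close>

section \<open>Fekete's lemma in two variables\<close>

lemma tendsto_div_over_self:
  assumes "a > 0"
  shows "((\<lambda>m::nat. real (m div a) / real m) \<longlongrightarrow> 1 / real a) at_top"
proof (rule tendsto_sandwich[where f = "\<lambda>m. 1 / real a - 1 / real m" and h = "\<lambda>m. 1 / real a"])
  show "\<forall>\<^sub>F m in at_top. 1 / real a - 1 / real m \<le> real (m div a) / real m"
    using eventually_gt_at_top[of 0]
  proof eventually_elim
    case (elim m)
    have "real m / real a - 1 \<le> real (m div a)"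
      using floor_divide_of_nat_eq[where 'a = real, of m a] by linarith
    hence "(real m / real a - 1) / real m \<le> real (m div a) / real m"
      by (rule divide_right_mono) simp
    thus ?case using elim assms by (simp add: diff_divide_distrib)
  qed
  show "\<forall>\<^sub>F m in at_top. real (m div a) / real m \<le> 1 / real a"
    using eventually_gt_at_top[of 0]
  proof eventually_elim
    case (elim m)
    have "real (m div a) / real m \<le> (real m / real a) / real m"
      using of_nat_div_le_of_nat by (rule divide_right_mono) simp
    thus ?case using elim by simp
  qed
  have "((\<lambda>m::nat. 1 / real a - 1 / real m) \<longlongrightarrow> 1 / real a - 0) at_top"
    by (intro tendsto_diff tendsto_const lim_1_over_n)
  thus "((\<lambda>m::nat. 1 / real a - 1 / real m) \<longlongrightarrow> 1 / real a) at_top" by simp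
qed simp

lemma superadditive_div_mult_le:
  fixes g :: "nat \<Rightarrow> nat"
  assumes add: "\<And>m m'. g m + g m' \<le> g (m + m')"
  shows "m div a * g a \<le> g m"
proof -
  have "q * g a \<le> g (q * a)" for q
  proof (induction q)
    case (Suc q)
    have "Suc q * g a \<le> g (q * a) + g a" using Suc by simp
    also have "\<dots> \<le> g (Suc q * a)" using add[of "q * a" a] by (simp add: add.commute)
    finally show ?case .
  qed simp
  from this[of "m div a"] add[of "m div a * a" "m mod a"] show ?thesis by simp
qed

text \<open>A board of fixed sides \<open>a\<close> and \<open>b\<close> tiles all but a vanishing fraction of a large board, so no
  ratio \<open>f a b / (a b)\<close> exceeds the limit inferior.\<close>

lemma superadditive_limit:
  fixes f :: "nat \<Rightarrow> nat \<Rightarrow> nat"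
  assumes add1: "\<And>m m' n. f m n + f m' n \<le> f (m + m') n"
    and add2: "\<And>m n n'. f m n + f m n' \<le> f m (n + n')"
    and bound: "\<And>m n. f m n \<le> m * n"
  obtains L :: real where
    "\<And>a b. a > 0 \<Longrightarrow> b > 0 \<Longrightarrow> real (f a b) / real (a * b) \<le> L"
    "\<And>m n :: nat \<Rightarrow> nat. filterlim m at_top sequentially \<Longrightarrow> filterlim n at_top sequentially \<Longrightarrow>
       (\<lambda>t. real (f (m t) (n t)) / real (m t * n t)) \<longlonglongrightarrow> L"
proof -
  define h where "h = (\<lambda>(a, b). real (f a b) / real (a * b))"
  define A where "A = {0::nat<..} \<times> {0::nat<..}"
  define L where "L = (SUP p\<in>A. h p)"
  have ne: "A \<noteq> {}" by (auto simp: A_def)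
  have "h p \<le> 1" for p
    using bound by (auto simp: h_def divide_le_eq split: prod.splits simp flip: of_nat_mult)
  hence bdd: "bdd_above (h ` A)" by (rule bdd_aboveI2)
  have le: "real (f a b) / real (a * b) \<le> L" if "a > 0" "b > 0" for a b
  proof -
    have "h (a, b) \<le> L" unfolding L_def
      by (rule cSUP_upper[OF _ bdd]) (use that in \<open>auto simp: A_def\<close>)
    thus ?thesis by (simp add: h_def)
  qed
  have tiles: "(m div a) * (n div b) * f a b \<le> f m n" for m n a b
  proof -
    have "(m div a) * ((n div b) * f a b) \<le> (m div a) * f a n"
      by (intro mult_le_mono order.refl superadditive_div_mult_le add2)
    also have "\<dots> \<le> f m n" by (rule superadditive_div_mult_le[OF add1])
    finally show ?thesis by (simp add: mult.assoc)
  qed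
  have lim: "(\<lambda>t. real (f (m t) (n t)) / real (m t * n t)) \<longlonglongrightarrow> L"
    if m: "filterlim m at_top sequentially" and n: "filterlim n at_top sequentially"
    for m n :: "nat \<Rightarrow> nat"
  proof (rule order_tendstoI)
    fix l assume "L < l"
    have "\<forall>\<^sub>F t in sequentially. m t > 0" "\<forall>\<^sub>F t in sequentially. n t > 0"
      by (rule eventually_compose_filterlim[OF eventually_gt_at_top], fact m n)+
    thus "\<forall>\<^sub>F t in sequentially. real (f (m t) (n t)) / real (m t * n t) < l"
      by eventually_elim (use le \<open>L < l\<close> in \<open>meson le_less_trans\<close>)
  next
    fix l assume "l < L"
    then obtain a b where ab: "a > 0" "b > 0" "l < real (f a b) / real (a * b)"
      unfolding L_def less_cSUP_iff[OF ne bdd] by (auto simp: A_def h_def)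
    let ?g = "\<lambda>t. real (m t div a) / real (m t) * (real (n t div b) / real (n t)) * real (f a b)"
    have "?g \<longlonglongrightarrow> 1 / real a * (1 / real b) * real (f a b)"
      by (intro tendsto_mult tendsto_const filterlim_compose[OF tendsto_div_over_self] m n ab)
    hence "\<forall>\<^sub>F t in sequentially. l < ?g t"
      by (rule order_tendstoD) (use ab in simp)
    thus "\<forall>\<^sub>F t in sequentially. l < real (f (m t) (n t)) / real (m t * n t)"
    proof eventually_elim
      case (elim t)
      have "?g t = real ((m t div a) * (n t div b) * f a b) / real (m t * n t)" by simp
      also have "\<dots> \<le> real (f (m t) (n t)) / real (m t * n t)"
        by (intro divide_right_mono of_nat_mono tiles) simp
      finally show ?case using elim by linarith
    qed
  qed
  show ?thesis by (rule that[OF le lim])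
qed

section \<open>Free cells of configurations\<close>

lemma finite_board [simp]: "finite (board m n)"
  by (simp add: board_def)

lemma card_board [simp]: "card (board m n) = m * n"
  by (simp add: board_def)

lemma finite_segment [simp]: "finite (segment k p d)"
  by (simp add: segment_def)

lemma card_segment_Int_ge_2:
  assumes "d \<in> directions" "i < k" "j < k" "i \<noteq> j"
    and "(fst p + int i * fst d, snd p + int i * snd d) \<in> T"
    and "(fst p + int j * fst d, snd p + int j * snd d) \<in> T"
  shows "card (segment k p d \<inter> T) \<ge> 2"
proof -
  let ?x = "\<lambda>i. (fst p + int i * fst d, snd p + int i * snd d)"
  have "?x i \<noteq> ?x j" using assms(1,4) by (auto simp: directions_def)
  hence "2 = card {?x i, ?x j}" by simp
  also have "\<dots> \<le> card (segment k p d \<inter> T)"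
    by (rule card_mono) (use assms in \<open>auto simp: segment_def\<close>)
  finally show ?thesis .
qed

lemma finite_configurations: "finite {S. configuration k (board m n) S}"
  by (rule finite_subset[of _ "Pow (board m n)"]) (auto simp: configuration_def)

lemma configuration_empty:
  assumes "k \<ge> 2"
  shows "configuration k B {}"
proof -
  have "card L \<ge> 2" if L: "L \<in> klines k B" for L
  proof -
    obtain p d where "d \<in> directions" "L = segment k p d"
      using L unfolding klines_def by blast
    thus ?thesis
      using card_segment_Int_ge_2[of d 0 k 1 p UNIV] assms by simp
  qed
  thus ?thesis by (simp add: configuration_def)
qed

text \<open>Equivalently, the least size of a set of cells that meets every line at least twice.\<close>

definition cover_number :: "nat \<Rightarrow> nat \<Rightarrow> nat \<Rightarrow> nat" where
  "cover_number k m n =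
     Min ((\<lambda>S. card (board m n - S)) ` {S. configuration k (board m n) S})"

lemma cover_number_le:
  assumes "configuration k (board m n) S"
  shows "cover_number k m n \<le> card (board m n - S)"
  unfolding cover_number_def by (rule Min_le) (use assms finite_configurations in auto)

lemma cover_number_attained:
  assumes "k \<ge> 2"
  obtains S where "configuration k (board m n) S" "cover_number k m n = card (board m n - S)"
proof -
  have "cover_number k m n \<in> (\<lambda>S. card (board m n - S)) ` {S. configuration k (board m n) S}"
    unfolding cover_number_def
    by (rule Min_in) (use configuration_empty[OF assms] finite_configurations in auto)
  thus ?thesis using that by auto
qed

text \<open>A configuration with the fewest free cells is saturated, so taking the maximum over saturated
  configurations is the same as taking it over all configurations.\<close>

lemma board_density_eq:
  assumes "k \<ge> 2" "m > 0" "n > 0"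
  shows "board_density k (board m n) = 1 - real (cover_number k m n) / real (m * n)"
proof -
  let ?B = "board m n"
  have size: "card S + card (?B - S) = m * n" if "S \<subseteq> ?B" for S
    using card_Diff_subset[OF finite_subset[OF that finite_board] that]
      card_mono[OF finite_board that] by simp
  obtain S where S: "configuration k ?B S" "cover_number k m n = card (?B - S)"
    using cover_number_attained[OF assms(1)] .
  have le: "card T \<le> card S" if "configuration k ?B T" for T
  proof -
    have "T \<subseteq> ?B" "S \<subseteq> ?B" using that S by (auto simp: configuration_def)
    thus ?thesis using cover_number_le[OF that] S(2) size[of T] size[of S] by linarith
  qed
  have "saturated k ?B S"
    unfolding saturated_def
  proof (intro conjI allI impI)
    fix T assume T: "configuration k ?B T \<and> S \<subseteq> T"
    hence "finite T" by (auto simp: configuration_def intro: finite_subset[OF _ finite_board])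
    thus "T = S" using T le[of T] card_seteq[of T S] by auto
  qed (rule S(1))
  moreover have "{S. saturated k ?B S} \<subseteq> {S. configuration k ?B S}"
    by (auto simp: saturated_def)
  ultimately have "board_density k ?B = real (card S) / real (card ?B)"
    unfolding board_density_def
    by (intro Max_eqI finite_imageI)
      (auto intro!: divide_right_mono le finite_subset[OF _ finite_configurations])
  moreover have "real (card S) = real (m * n) - real (cover_number k m n)"
  proof -
    have "S \<subseteq> ?B" using S(1) by (simp add: configuration_def)
    from size[OF this] S(2) show ?thesis by linarith
  qed
  ultimately show ?thesis using assms by (simp add: field_simps)
qed

section \<open>Superadditivity\<close>

abbreviation shift :: "int \<Rightarrow> int \<Rightarrow> int \<times> int \<Rightarrow> int \<times> int" where
  "shift u v \<equiv> (\<lambda>(x, y). (u + x, v + y))"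

lemma inj_shift: "inj (shift u v)"
  by (auto simp: inj_def)

lemma shift_segment: "shift u v ` segment k p d = segment k (shift u v p) d"
  by (force simp: segment_def image_iff split: prod.splits)

lemma card_shifted_Diff: "card (shift u v ` A - S) = card (A - shift u v -` S)"
proof -
  have "shift u v ` A - S = shift u v ` (A - shift u v -` S)" by auto
  thus ?thesis by (simp add: card_image inj_on_subset[OF inj_shift])
qed

lemma cover_number_le_shifted:
  assumes S: "configuration k (board m n) S" and sub: "shift u v ` board a b \<subseteq> board m n"
  shows "cover_number k a b \<le> card (shift u v ` board a b - S)"
proof -
  have "card (L - (board a b \<inter> shift u v -` S)) \<ge> 2" if L: "L \<in> klines k (board a b)" for L
  proof -
    obtain p d where pd: "p \<in> board a b" "d \<in> directions" "L = segment k p d" "L \<subseteq> board a b"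
      using L by (auto simp: klines_def)
    have "shift u v p \<in> board m n" "shift u v ` L = segment k (shift u v p) d"
      "shift u v ` L \<subseteq> board m n"
      using pd sub shift_segment[of u v k p d] by blast+
    hence "shift u v ` L \<in> klines k (board m n)"
      using pd(2) unfolding klines_def by blast
    hence "2 \<le> card (shift u v ` L - S)"
      using S by (auto simp: configuration_def)
    also have "\<dots> = card (L - shift u v -` S)" by (rule card_shifted_Diff)
    also have "L - shift u v -` S = L - (board a b \<inter> shift u v -` S)" using pd by blast
    finally show ?thesis .
  qed
  hence "configuration k (board a b) (board a b \<inter> shift u v -` S)"
    by (simp add: configuration_def)
  hence "cover_number k a b \<le> card (board a b - (board a b \<inter> shift u v -` S))"
    by (rule cover_number_le)
  also have "board a b - (board a b \<inter> shift u v -` S) = board a b - shift u v -` S" by blast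
  finally show ?thesis by (simp only: card_shifted_Diff)
qed

lemma cover_number_split:
  assumes k: "k \<ge> 2"
    and split: "board m n = board a b \<union> shift u v ` board a' b'"
    and disj: "board a b \<inter> shift u v ` board a' b' = {}"
  shows "cover_number k a b + cover_number k a' b' \<le> cover_number k m n"
proof -
  obtain S where S: "configuration k (board m n) S" "cover_number k m n = card (board m n - S)"
    using cover_number_attained[OF k] .
  have id: "shift 0 0 ` board a b = board a b" by (simp add: case_prod_unfold)
  have "cover_number k a b \<le> card (board a b - S)"
    using cover_number_le_shifted[OF S(1), of 0 0 a b] split unfolding id by blast
  moreover have "cover_number k a' b' \<le> card (shift u v ` board a' b' - S)"
    using cover_number_le_shifted[OF S(1)] split by blast
  moreover have "card (board m n - S) = card (board a b - S) + card (shift u v ` board a' b' - S)"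
    unfolding split Un_Diff by (rule card_Un_disjoint) (use disj in auto)
  ultimately show ?thesis using S(2) by linarith
qed

lemma shift_board: "shift u v ` board a b = {u + 1..u + int a} \<times> {v + 1..v + int b}"
proof -
  have "shift u v ` board a b = (+) u ` {1..int a} \<times> (+) v ` {1..int b}"
    unfolding board_def by (auto simp del: image_add_atLeastAtMost)
  thus ?thesis by (simp add: add.commute)
qed

lemma cover_number_add_left:
  "k \<ge> 2 \<Longrightarrow> cover_number k m n + cover_number k m' n \<le> cover_number k (m + m') n"
  by (rule cover_number_split[where u = "int m" and v = 0])
    (unfold shift_board, auto simp: board_def)

lemma cover_number_add_right:
  "k \<ge> 2 \<Longrightarrow> cover_number k m n + cover_number k m n' \<le> cover_number k m (n + n')"
  by (rule cover_number_split[where u = 0 and v = "int n"])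
    (unfold shift_board, auto simp: board_def)

lemma cover_number_le_area:
  assumes "k \<ge> 2"
  shows "cover_number k m n \<le> m * n"
  using cover_number_le[OF configuration_empty[OF assms]] by simp

lemma cover_number_line:
  assumes "k \<ge> 2"
  shows "cover_number k k 1 \<ge> 2"
proof -
  obtain S where S: "configuration k (board k 1) S" "cover_number k k 1 = card (board k 1 - S)"
    using cover_number_attained[OF assms] .
  have "board k 1 = segment k (1, 1) (1, 0)"
  proof (intro set_eqI iffI; clarify)
    fix x y assume "(x, y) \<in> board k 1"
    hence "1 \<le> x" "x \<le> int k" "y = 1" by (auto simp: board_def)
    thus "(x, y) \<in> segment k (1, 1) (1, 0)"
      by (auto simp: segment_def intro!: exI[of _ "nat (x - 1)"])
  qed (auto simp: segment_def board_def)
  hence "board k 1 \<in> klines k (board k 1)"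
    unfolding klines_def using assms by (force simp: board_def directions_def)
  thus ?thesis using S by (auto simp: configuration_def)
qed

section \<open>A periodic pattern\<close>

definition pattern :: "nat \<Rightarrow> (int \<times> int) set" where
  "pattern q = {(x, y). (x + 2 * y) mod int q \<in> {0, 1}}"

lemma coprime_step_hits:
  fixes c s r :: int
  assumes "coprime s (int q)" "q > 0"
  obtains j where "j < q" "(c + int j * s) mod int q = r mod int q"
proof -
  obtain u v where uv: "u * s + v * int q = 1"
    using bezout_int[of s "int q"] assms(1) by auto
  define j where "j = nat ((u * (r - c)) mod int q)"
  have j: "int j = (u * (r - c)) mod int q" using assms by (simp add: j_def)
  have "(c + int j * s) mod int q = (c + u * (r - c) * s) mod int q"
    unfolding j by (metis mod_add_right_eq mod_mult_left_eq)
  also have "c + u * (r - c) * s = r + int q * (v * (c - r))"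
  proof -
    have "u * s = 1 - v * int q" using uv by simp
    thus ?thesis by algebra
  qed
  also have "(r + int q * (v * (c - r))) mod int q = r mod int q" by simp
  finally show ?thesis
    using that[of j] j assms by (metis of_nat_0_less_iff of_nat_less_iff pos_mod_bound)
qed

lemma step_hits_twice:
  fixes c s :: int
  assumes q: "q \<ge> 2" "\<not> 3 dvd q" and s: "s \<in> {1, -1, 2, -2, 3, -3}"
  obtains i j where "i < q" "j < q" "i \<noteq> j"
    "(c + int i * s) mod int q \<in> {0, 1}" "(c + int j * s) mod int q \<in> {0, 1}"
proof (cases "coprime s (int q)")
  case True
  have "q > 0" using q by simp
  obtain i where i: "i < q" "(c + int i * s) mod int q = 0 mod int q"
    by (rule coprime_step_hits[OF True \<open>q > 0\<close>])
  obtain j where j: "j < q" "(c + int j * s) mod int q = 1 mod int q"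
    by (rule coprime_step_hits[OF True \<open>q > 0\<close>])
  have "i \<noteq> j" using i j q by auto
  thus ?thesis using that[of i j] i j q by auto
next
  case False
  have "coprime 3 (int q)"
  proof -
    have "prime (3::int)" by simp
    moreover have "\<not> 3 dvd int q" using q(2) by presburger
    ultimately show ?thesis using prime_imp_coprime by blast
  qed
  hence s2: "s = 2 \<or> s = -2" and "\<not> coprime 2 (int q)" using s False by auto
  then obtain h where h: "q = 2 * h" by (auto simp: coprime_left_2_iff_odd elim: evenE)
  define e where "e = s div 2"
  have e: "s = 2 * e" "coprime e (int h)" using s2 by (auto simp: e_def)
  have "h > 0" using h q by simp
  \<comment> \<open>Halving \<open>c\<close> and the step turns the problem into one with a unit step modulo \<open>h\<close>.\<close>
  obtain j where j: "j < h" "(c div 2 + int j * e) mod int h = 0 mod int h"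
    by (rule coprime_step_hits[OF e(2) \<open>h > 0\<close>])
  then obtain w where w: "c div 2 + int j * e = int h * w"
    by (metis dvd_def mod_0 mod_eq_0_iff_dvd)
  have c: "c = 2 * (c div 2) + c mod 2" by simp
  have "c + int j * s = c mod 2 + 2 * (c div 2 + int j * e)"
    unfolding e(1) distrib_left using c by linarith
  also have "\<dots> = c mod 2 + int q * w" unfolding w by (simp add: h)
  finally have cj: "c + int j * s = c mod 2 + int q * w" .
  hence 1: "(c + int j * s) mod int q = c mod 2 mod int q" by simp
  have "c + int (j + h) * s = c mod 2 + int q * (w + e)"
    using cj by (simp add: h e algebra_simps)
  hence 2: "(c + int (j + h) * s) mod int q = c mod 2 mod int q" by simp
  have "c mod 2 mod int q \<in> {0, 1}"
    using q by (cases "even c") (auto simp: even_iff_mod_2_eq_zero odd_iff_mod_2_eq_one)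
  thus ?thesis using that[of j "j + h"] j(1) h \<open>h > 0\<close> 1 2 by auto
qed

lemma pattern_meets_segments:
  assumes q: "q \<ge> 2" "\<not> 3 dvd q" "q \<le> k" and d: "d \<in> directions"
  shows "card (segment k p d \<inter> pattern q) \<ge> 2"
proof -
  let ?c = "fst p + 2 * snd p" and ?s = "fst d + 2 * snd d"
  have "?s \<in> {1, -1, 2, -2, 3, -3}" using d by (auto simp: directions_def)
  then obtain i j where "i < q" "j < q" "i \<noteq> j"
    "(?c + int i * ?s) mod int q \<in> {0, 1}" "(?c + int j * ?s) mod int q \<in> {0, 1}"
    using step_hits_twice[OF q(1,2)] by metis
  thus ?thesis
    by (intro card_segment_Int_ge_2[OF d, of i k j]) (use q in \<open>auto simp: pattern_def algebra_simps\<close>)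
qed

lemma card_residue_class_le:
  fixes c r :: int
  assumes "q > 0"
  shows "card {x \<in> {1..int (q * t)}. (x + c) mod int q = r} \<le> t"
proof -
  let ?u = "(c - r) div int q"
  have "{x \<in> {1..int (q * t)}. (x + c) mod int q = r} \<subseteq>
        (\<lambda>z. int q * z + r - c) ` {?u + 1..?u + int t}"
  proof (rule subsetI)
    fix x assume "x \<in> {x \<in> {1..int (q * t)}. (x + c) mod int q = r}"
    hence x: "x \<in> {1..int (q * t)}" "r = (x + c) mod int q" by auto
    define z where "z = (x + c) div int q"
    have z: "x = int q * z + r - c"
      unfolding z_def x(2) by (simp add: mult_div_mod_eq)
    have *: "c - r = int q * ?u + (c - r) mod int q" by simp
    have **: "0 \<le> (c - r) mod int q" "(c - r) mod int q < int q" using assms by auto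
    have x1: "1 \<le> x" "x \<le> int q * int t" using x(1) by auto
    have "int q * ?u < int q * z" using x1(1) z * ** by linarith
    hence "?u < z" using assms by simp
    moreover have "int q * z < int q * (?u + int t + 1)"
      unfolding distrib_left using x1(2) z * ** by linarith
    hence "z < ?u + int t + 1" using assms by (simp only: mult_less_cancel_left_pos of_nat_0_less_iff)
    ultimately show "x \<in> (\<lambda>z. int q * z + r - c) ` {?u + 1..?u + int t}"
      using z by auto
  qed
  hence "card {x \<in> {1..int (q * t)}. (x + c) mod int q = r}
      \<le> card ((\<lambda>z. int q * z + r - c) ` {?u + 1..?u + int t})"
    by (rule card_mono[rotated]) simp
  also have "\<dots> \<le> card {?u + 1..?u + int t}" by (rule card_image_le) simp
  finally show ?thesis by simp
qed

lemma card_board_Int_pattern_le: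
  assumes "q > 0"
  shows "card (board (q * t) n \<inter> pattern q) \<le> 2 * t * n"
proof -
  let ?R = "\<lambda>y r. {x \<in> {1..int (q * t)}. (x + 2 * y) mod int q = r}"
  have "board (q * t) n \<inter> pattern q = (\<Union>y\<in>{1..int n}. (?R y 0 \<union> ?R y 1) \<times> {y})"
    by (auto simp: board_def pattern_def)
  hence "card (board (q * t) n \<inter> pattern q) \<le> (\<Sum>y\<in>{1..int n}. card ((?R y 0 \<union> ?R y 1) \<times> {y}))"
    by (simp only:) (rule card_UN_le, simp)
  also have "\<dots> \<le> (\<Sum>y\<in>{1..int n}. 2 * t)"
  proof (rule sum_mono)
    fix y
    have "card (?R y 0 \<union> ?R y 1) \<le> card (?R y 0) + card (?R y 1)" by (rule card_Un_le)
    also have "\<dots> \<le> t + t" by (intro add_mono card_residue_class_le assms)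
    finally show "card ((?R y 0 \<union> ?R y 1) \<times> {y}) \<le> 2 * t" by (simp add: card_cartesian_product)
  qed
  finally show ?thesis by (simp add: mult.commute)
qed

text \<open>Only boards whose first side is a multiple of the period are needed, because the limit is
  known to exist; on them the count of the pattern has no boundary error.\<close>

lemma cover_density_le:
  assumes q: "q \<ge> 2" "\<not> 3 dvd q" "q \<le> k" and t: "t > 0" and n: "n > 0"
  shows "real (cover_number k (q * t) n) / real (q * t * n) \<le> 2 / real q"
proof -
  let ?B = "board (q * t) n"
  have "card (L - (?B - pattern q)) \<ge> 2" if L: "L \<in> klines k ?B" for L
  proof -
    obtain p d where pd: "d \<in> directions" "L = segment k p d" "L \<subseteq> ?B"
      using L by (auto simp: klines_def)
    have "L - (?B - pattern q) = L \<inter> pattern q" using pd by blast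
    thus ?thesis using pattern_meets_segments[OF q pd(1)] pd(2) by simp
  qed
  hence "configuration k ?B (?B - pattern q)" by (simp add: configuration_def)
  hence "cover_number k (q * t) n \<le> card (?B - (?B - pattern q))" by (rule cover_number_le)
  also have "\<dots> \<le> 2 * t * n" using card_board_Int_pattern_le[of q] q by (simp add: Diff_Diff_Int)
  finally have "real (cover_number k (q * t) n) \<le> real (2 * t * n)" by (rule of_nat_mono)
  thus ?thesis using q t n by (simp add: field_simps)
qed

section \<open>The density of the plane\<close>

lemma plane_density_eqI:
  assumes "\<And>m n :: nat \<Rightarrow> nat. filterlim m at_top sequentially \<Longrightarrow>
      filterlim n at_top sequentially \<Longrightarrow> (\<lambda>t. board_density k (board (m t) (n t))) \<longlonglongrightarrow> D"
  shows "plane_density k = D"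
  unfolding plane_density_def
proof (rule the_equality)
  fix D' assume D': "\<forall>m n. filterlim m at_top sequentially \<longrightarrow> filterlim n at_top sequentially \<longrightarrow>
      (\<lambda>t. board_density k (board (m t) (n t))) \<longlonglongrightarrow> D'"
  have id: "filterlim (\<lambda>t::nat. t) at_top sequentially" by (rule filterlim_ident)
  show "D' = D" using LIMSEQ_unique[OF _ assms[OF id id]] D' id by blast
qed (use assms in blast)

lemma plane_density_bounds:
  assumes k: "k \<ge> 2"
  shows "plane_density k \<le> 1 - 2 / real k"
    and "\<And>q. q \<ge> 2 \<Longrightarrow> \<not> 3 dvd q \<Longrightarrow> q \<le> k \<Longrightarrow> 1 - 2 / real q \<le> plane_density k"
proof -
  obtain L :: real where
    L_ge: "\<And>a b. a > 0 \<Longrightarrow> b > 0 \<Longrightarrow> real (cover_number k a b) / real (a * b) \<le> L" and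
    L_lim: "\<And>m n :: nat \<Rightarrow> nat. filterlim m at_top sequentially \<Longrightarrow>
       filterlim n at_top sequentially \<Longrightarrow>
       (\<lambda>t. real (cover_number k (m t) (n t)) / real (m t * n t)) \<longlonglongrightarrow> L"
    by (rule superadditive_limit[of "cover_number k"])
      (use k cover_number_add_left cover_number_add_right cover_number_le_area in auto)
  have density: "plane_density k = 1 - L"
  proof (rule plane_density_eqI)
    fix m n :: "nat \<Rightarrow> nat"
    assume mn: "filterlim m at_top sequentially" "filterlim n at_top sequentially"
    have "\<forall>\<^sub>F t in sequentially. m t > 0" "\<forall>\<^sub>F t in sequentially. n t > 0"
      by (rule eventually_compose_filterlim[OF eventually_gt_at_top], fact mn)+
    hence "\<forall>\<^sub>F t in sequentially. 1 - real (cover_number k (m t) (n t)) / real (m t * n t)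
        = board_density k (board (m t) (n t))"
      by eventually_elim (simp add: board_density_eq k)
    thus "(\<lambda>t. board_density k (board (m t) (n t))) \<longlonglongrightarrow> 1 - L"
      by (rule Lim_transform_eventually[rotated]) (intro tendsto_diff tendsto_const L_lim mn)
  qed
  have "2 / real k \<le> real (cover_number k k 1) / real (k * 1)"
    using cover_number_line[OF k] by (simp add: divide_right_mono)
  also have "\<dots> \<le> L" by (rule L_ge) (use k in auto)
  finally show "plane_density k \<le> 1 - 2 / real k" using density by simp
  fix q :: nat assume q: "q \<ge> 2" "\<not> 3 dvd q" "q \<le> k"
  have "(\<lambda>t. real (cover_number k (q * t) t) / real (q * t * t)) \<longlonglongrightarrow> L"
  proof (rule L_lim)
    show "filterlim (\<lambda>t. q * t) at_top sequentially"
      by (rule filterlim_at_top_mono[OF filterlim_ident]) (use q in auto)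
  qed (rule filterlim_ident)
  hence "L \<le> 2 / real q"
    by (rule LIMSEQ_le_const2) (use cover_density_le[OF q] in \<open>auto intro!: exI[of _ 1]\<close>)
  thus "1 - 2 / real q \<le> plane_density k" using density by simp
qed

theorem mainTheorem2:
  fixes k :: nat
  assumes "k \<ge> 2"
  shows "1 - 2 / (real k - 1) \<le> plane_density k \<and> plane_density k \<le> 1 - 2 / real k
         \<and> (\<not> 3 dvd k \<longrightarrow> plane_density k = 1 - 2 / real k)"
proof (cases "3 dvd k")
  case True
  hence "k - 1 \<ge> 2" "\<not> 3 dvd (k - 1)" using assms by presburger+
  hence "1 - 2 / real (k - 1) \<le> plane_density k" using plane_density_bounds(2)[OF assms, of "k - 1"] by simp
  thus ?thesis using True assms plane_density_bounds(1)[OF assms] by (simp add: of_nat_diff)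
next
  case False
  hence "plane_density k = 1 - 2 / real k"
    using plane_density_bounds(1)[OF assms] plane_density_bounds(2)[OF assms, of k] assms
    by (intro antisym) auto
  moreover have "2 / real k \<le> 2 / (real k - 1)" using assms by (intro divide_left_mono) auto
  ultimately show ?thesis by simp
qed

end
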